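(* Let $N\ge2$ be an integer and $b_1,\dots,b_N\in\mathbb{Q}$ with $b_N\neq0$ and $b_{N-1}+b_N=-1$, and let $b\in\mathbb{Q}$. Let \[R(x_1,\dots,x_N):=(1+x_1)^{b_1}(1+x_1+x_2)^{b_2}\cdots(1+x_1+\dots+x_N)^{b_N},\] and $B(k):=-(b_k+\dots+b_N)$. For $k=1,\dots,N-2$ let \[u^k:=\left(\tfrac{B(k)-b}{N-k+1},\tfrac{B(k)-b+1}{N-k+1},\dots,\tfrac{B(k)-b+N-k}{N-k+1}\right),\quad v^k:=\left(\tfrac{B(k)-b}{N-k},\tfrac{B(k)-b+1}{N-k},\dots,\tfrac{B(k)-b+N-k-1}{N-k}\right),\] let $u^{N-1}:=(1-b)/2$, $u^N:=-b_N$, and let $v^{N-1}:=(1,\dots,1)$ consist of exactly $N-1$ ones. Let $u:=(u^1,\dots,u^N)$ (of length $M-1$, where $M:=N(N+1)/2$) and $v:=(v^1,\dots,v^{N-1})$ (of length $M-2$). Then \[\operatorname{Diag}\big((1+x_1+\dots+x_{N-2}+2x_{N-1})^b\cdot R(x_1,\dots,x_N)\big)={}_{M-1}F_{M-2}(u;v;(-N)^Nt).\]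
   Context: All power series have coefficients in $\mathbb{Q}$. For $a\in\mathbb{Q}$ and a power series $L$ with zero constant term, $(1+L)^a:=\sum_{j\ge0}\binom{a}{j}L^j$ with $\binom{a}{j}=a(a-1)\cdots(a-j+1)/j!$. For $g=\sum g_{i_1,\dots,i_N}x_1^{i_1}\cdots x_N^{i_N}$, $\operatorname{Diag}(g):=\sum_{j\ge0}g_{j,\dots,j}t^j$. For tuples $u=(a_1,\dots,a_p)$, $v=(b_1,\dots,b_q)$, ${}_pF_q(u;v;t):=\sum_{j\ge0}\frac{(a_1)_j\cdots(a_p)_j}{(b_1)_j\cdots(b_q)_j}\frac{t^j}{j!}$ with $(x)_j=x(x+1)\cdots(x+j-1)$, defined when no $b_i+j$ ($j\in\mathbb{N}$) vanishes. *)

theory Defs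
  imports
    "HOL-Library.Poly_Mapping"
    "HOL-Computational_Algebra.Formal_Power_Series"
begin

text \<open>
  Formal power series in the variables $x_0, x_1, x_2, \ldots$: a monomial is its finitely supported
  exponent vector \<^typ>\<open>nat \<Rightarrow>\<^sub>0 nat\<close>, and a series is an arbitrary family of coefficients indexed by
  monomials. Power series in $x_1, \ldots, x_N$ are the members in which no other variable occurs.
\<close>

typedef 'a mfps = "UNIV :: ((nat \<Rightarrow>\<^sub>0 nat) \<Rightarrow> 'a) set"
  morphisms mcoeff Abs_mfps
  by simp

setup_lifting type_definition_mfps

lemma mfps_eqI: "(\<And>m. mcoeff f m = mcoeff g m) \<Longrightarrow> f = g"
  by (auto simp flip: mcoeff_inject)

lemma finite_splits: "finite {p. fst p + snd p = (m :: nat \<Rightarrow>\<^sub>0 nat)}"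
proof -
  let ?K = "Poly_Mapping.keys m"
  let ?S = "\<Sum>k\<in>?K. Poly_Mapping.lookup m k"
  let ?F = "{f. \<forall>k. (k \<in> ?K \<longrightarrow> f k \<in> {..?S}) \<and> (k \<notin> ?K \<longrightarrow> f k = (0::nat))}"
  let ?A = "{a. \<exists>b. a + b = m}"
  have fin: "finite ?F"
    by (rule finite_set_of_finite_funs) auto
  have "Poly_Mapping.lookup a \<in> ?F" if "a \<in> ?A" for a
  proof -
    from that have le: "Poly_Mapping.lookup a k \<le> Poly_Mapping.lookup m k" for k
      by (auto simp: lookup_add)
    have "Poly_Mapping.lookup a k \<le> ?S" if "k \<in> ?K" for k
      using le[of k] member_le_sum[of k ?K "Poly_Mapping.lookup m"] that by simp
    moreover have "Poly_Mapping.lookup a k = 0" if "k \<notin> ?K" for k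
      using le[of k] that by (simp add: in_keys_iff)
    ultimately show ?thesis
      by simp
  qed
  then have "finite (Poly_Mapping.lookup ` ?A)"
    using fin by (meson finite_subset image_subsetI)
  then have "finite ?A"
    by (rule finite_imageD) (simp add: inj_on_def lookup_inject)
  then have "finite ((\<lambda>a. (a, m - a)) ` ?A)"
    by simp
  moreover have "{p. fst p + snd p = m} \<subseteq> (\<lambda>a. (a, m - a)) ` ?A"
    by (auto simp: image_iff)
  ultimately show ?thesis
    by (rule finite_subset[rotated])
qed

instantiation mfps :: (comm_ring_1) comm_ring_1
begin

lift_definition zero_mfps :: "'a mfps" is "\<lambda>_. 0" .
lift_definition one_mfps :: "'a mfps" is "\<lambda>m. if m = 0 then 1 else 0" .
lift_definition plus_mfps :: "'a mfps \<Rightarrow> 'a mfps \<Rightarrow> 'a mfps" is "\<lambda>f g m. f m + g m" .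
lift_definition uminus_mfps :: "'a mfps \<Rightarrow> 'a mfps" is "\<lambda>f m. - f m" .
lift_definition minus_mfps :: "'a mfps \<Rightarrow> 'a mfps \<Rightarrow> 'a mfps" is "\<lambda>f g m. f m - g m" .
lift_definition times_mfps :: "'a mfps \<Rightarrow> 'a mfps \<Rightarrow> 'a mfps"
  is "\<lambda>f g m. \<Sum>p | fst p + snd p = m. f (fst p) * g (snd p)" .

instance
proof
  fix f g h :: "'a mfps"
  show "f + g + h = f + (g + h)" by transfer (simp add: algebra_simps)
  show "f + g = g + f" by transfer (simp add: algebra_simps)
  show "0 + f = f" by transfer simp
  show "- f + f = 0" by transfer simp
  show "f - g = f + - g" by transfer simp
  show "(f + g) * h = f * h + g * h"
    by transfer (simp add: algebra_simps sum.distrib)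
  show "(0 :: 'a mfps) \<noteq> 1" by transfer (auto simp: fun_eq_iff)
  show "f * g = g * f"
    by transfer
      (rule ext, rule sum.reindex_bij_witness[of _ "\<lambda>(a, b). (b, a)" "\<lambda>(a, b). (b, a)"],
       auto simp: add.commute mult.commute)
  show "1 * f = f"
  proof (transfer, rule ext)
    fix f :: "(nat \<Rightarrow>\<^sub>0 nat) \<Rightarrow> 'a" and m
    have "(\<Sum>p | fst p + snd p = m. (if fst p = 0 then 1 else 0) * f (snd p)) =
        (\<Sum>p\<in>{(0 :: nat \<Rightarrow>\<^sub>0 nat, m)}. (if fst p = 0 then 1 else 0) * f (snd p))"
      by (rule sum.mono_neutral_right) (auto simp: finite_splits)
    then show "(\<Sum>p | fst p + snd p = m. (if fst p = 0 then 1 else 0) * f (snd p)) = f m"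
      by simp
  qed
  show "f * g * h = f * (g * h)"
  proof (transfer, rule ext)
    fix f g h :: "(nat \<Rightarrow>\<^sub>0 nat) \<Rightarrow> 'a" and m
    show "(\<Sum>p | fst p + snd p = m.
          (\<Sum>q | fst q + snd q = fst p. f (fst q) * g (snd q)) * h (snd p)) =
        (\<Sum>p | fst p + snd p = m.
          f (fst p) * (\<Sum>q | fst q + snd q = snd p. g (fst q) * h (snd q)))"
      unfolding sum_distrib_left sum_distrib_right
      by (subst (1 2) sum.Sigma)
        (auto simp: finite_splits split_def
          intro!: sum.reindex_bij_witness[of _
            "\<lambda>(p, q). ((fst p + fst q, snd q), (fst p, fst q))"
            "\<lambda>(p, q). ((fst q, snd q + snd p), (snd q, snd p))"]
          simp: add.assoc mult.assoc)
  qed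
qed

end

lift_definition mvar :: "nat \<Rightarrow> 'a::comm_ring_1 mfps"
  is "\<lambda>i m. if m = Poly_Mapping.single i 1 then 1 else 0" .

text \<open>
  The series $(1+L)^a = \sum_j \binom{a}{j} L^j$, coefficient by coefficient. Here \<^const>\<open>Sum_any\<close> is
  the sum over all natural numbers \<open>j\<close> of a finitely supported family; when \<open>L\<close> has zero constant term
  the support is indeed finite, by \<open>mcoeff_power_eq_0\<close> below.
\<close>

definition one_plus_powr :: "'a::field_char_0 mfps \<Rightarrow> 'a \<Rightarrow> 'a mfps"
  where "one_plus_powr L a = Abs_mfps (\<lambda>m. Sum_any (\<lambda>j. (a gchoose j) * mcoeff (L ^ j) m))"

definition total_degree :: "(nat \<Rightarrow>\<^sub>0 nat) \<Rightarrow> nat"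
  where "total_degree m = (\<Sum>k\<in>Poly_Mapping.keys m. Poly_Mapping.lookup m k)"

lemma total_degree_add: "total_degree (a + b) = total_degree a + total_degree b"
proof -
  have *: "total_degree c = (\<Sum>k\<in>Poly_Mapping.keys a \<union> Poly_Mapping.keys b. Poly_Mapping.lookup c k)"
    if "Poly_Mapping.keys c \<subseteq> Poly_Mapping.keys a \<union> Poly_Mapping.keys b" for c
    unfolding total_degree_def using that
    by (intro sum.mono_neutral_left) (auto simp: in_keys_iff)
  show ?thesis
    using Poly_Mapping.keys_add[of a b] by (simp add: * lookup_add sum.distrib)
qed

lemma total_degree_eq_0_iff: "total_degree m = 0 \<longleftrightarrow> m = 0"
  by (auto simp: total_degree_def in_keys_iff intro!: poly_mapping_eqI)

lemma mcoeff_power_eq_0: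
  fixes L :: "'a::comm_ring_1 mfps"
  assumes "mcoeff L 0 = 0" "total_degree m < j"
  shows "mcoeff (L ^ j) m = 0"
  using assms(2)
proof (induction j arbitrary: m)
  case (Suc j)
  have "mcoeff L a * mcoeff (L ^ j) b = 0" if "a + b = m" for a b
  proof (cases "a = 0")
    case False
    then have "total_degree b < j"
      using Suc.prems that total_degree_add[of a b] total_degree_eq_0_iff[of a] by auto
    then show ?thesis
      by (simp add: Suc.IH)
  qed (simp add: assms(1))
  then show ?case
    by (auto simp: times_mfps.rep_eq intro!: sum.neutral)
qed simp

lemma finite_one_plus_powr_support:
  fixes L :: "'a::field_char_0 mfps"
  assumes "mcoeff L 0 = 0"
  shows "finite {j. (a gchoose j) * mcoeff (L ^ j) m \<noteq> 0}"
  by (rule finite_subset[of _ "{..total_degree m}"])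
    (use mcoeff_power_eq_0[OF assms] in \<open>force simp: not_le[symmetric]\<close>)+

definition Diag :: "nat \<Rightarrow> 'a::comm_ring_1 mfps \<Rightarrow> 'a fps"
  where "Diag N g = Abs_fps (\<lambda>j. mcoeff g (\<Sum>i = 1..N. Poly_Mapping.single i j))"

definition R_series :: "nat \<Rightarrow> (nat \<Rightarrow> rat) \<Rightarrow> rat mfps"
  where "R_series N bs = (\<Prod>k = 1..N. one_plus_powr (\<Sum>i = 1..k. mvar i) (bs k))"

definition B_sum :: "nat \<Rightarrow> (nat \<Rightarrow> rat) \<Rightarrow> nat \<Rightarrow> rat"
  where "B_sum N bs k = - (\<Sum>i = k..N. bs i)"

text \<open>The blocks $u^k$ and $v^k$ for $1 \le k \le N - 2$.\<close>

definition u_block :: "nat \<Rightarrow> (nat \<Rightarrow> rat) \<Rightarrow> rat \<Rightarrow> nat \<Rightarrow> rat list"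
  where "u_block N bs b k =
    map (\<lambda>i. (B_sum N bs k - b + of_nat i) / of_nat (N - k + 1)) [0..<N - k + 1]"

definition v_block :: "nat \<Rightarrow> (nat \<Rightarrow> rat) \<Rightarrow> rat \<Rightarrow> nat \<Rightarrow> rat list"
  where "v_block N bs b k =
    map (\<lambda>i. (B_sum N bs k - b + of_nat i) / of_nat (N - k)) [0..<N - k]"

definition u_params :: "nat \<Rightarrow> (nat \<Rightarrow> rat) \<Rightarrow> rat \<Rightarrow> rat list"
  where "u_params N bs b =
    concat (map (u_block N bs b) [1..<N - 1]) @ [(1 - b) / 2] @ [- bs N]"

definition v_params :: "nat \<Rightarrow> (nat \<Rightarrow> rat) \<Rightarrow> rat \<Rightarrow> rat list"
  where "v_params N bs b =
    concat (map (v_block N bs b) [1..<N - 1]) @ replicate (N - 1) 1"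

end

theory Submission
  imports Defs "HOL-Computational_Algebra.Polynomial"
begin

unbundle fps_syntax

text \<open>
  Write $S_k = 1 + x_1 + \dots + x_k$. The coefficient of $x_1^n \cdots x_N^n$ is extracted one variable
  at a time, starting with $x_N$, by means of $[x_k^n] S_k^a = \binom{a}{n} S_{k-1}^{a-n}$. The
  hypothesis $b_{N-1} + b_N = -1$ makes the exponent of $S_{N-1}$ equal to $-n-1$ in the second step,
  where the extra factor contributes
  $[x^n] (1+2x)^b (1+x)^{-n-1} = 4^n \binom{(b-1)/2}{n}$. The remaining steps produce the factors
  $\binom{b - B(k) - (N-k) n}{n}$ for $k \le N-2$; each is a quotient of the Pochhammer symbols
  $(B(k)-b)_{(N-k+1)n}$ and $(B(k)-b)_{(N-k)n}$, which the multiplication formula splits into the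
  blocks $u^k$ and $v^k$. The powers left over telescope to $N^{Nn} / 4^n$.
\<close>

section \<open>Constant series and linearity of coefficients\<close>

lift_definition mconst :: "'a \<Rightarrow> 'a::comm_ring_1 mfps"
  is "\<lambda>c m. if m = 0 then c else 0" .

lemma mcoeff_zero [simp]: "mcoeff 0 m = 0"
  by transfer simp

lemma mcoeff_add [simp]: "mcoeff (f + g) m = mcoeff f m + mcoeff g m"
  by transfer simp

lemma mcoeff_sum: "mcoeff (\<Sum>i\<in>A. f i) m = (\<Sum>i\<in>A. mcoeff (f i) m)"
  by (induction A rule: infinite_finite_induct) auto

lemma mcoeff_mconst_mult [simp]: "mcoeff (mconst c * f) m = c * mcoeff f m"
proof -
  have "mcoeff (mconst c * f) m
      = (\<Sum>p | fst p + snd p = m. (if fst p = 0 then c else 0) * mcoeff f (snd p))"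
    by (simp add: times_mfps.rep_eq mconst.rep_eq)
  also have "\<dots> = (\<Sum>p\<in>{(0 :: nat \<Rightarrow>\<^sub>0 nat, m)}. (if fst p = 0 then c else 0) * mcoeff f (snd p))"
    by (rule sum.mono_neutral_right) (auto simp: finite_splits)
  finally show ?thesis by simp
qed

lemma mconst_mult_mconst: "mconst c * (mconst d * f) = mconst (c * d) * f"
  by (rule mfps_eqI) (simp add: mult.assoc)

lemma mconst_1: "mconst 1 = 1"
  by transfer simp

lemma mconst_0: "mconst 0 = 0"
  by transfer auto

lemma mconst_add: "mconst (c + d) = mconst c + mconst d"
  by transfer (auto simp: fun_eq_iff)

text \<open>Lets the 2 in \<open>2 * mvar i\<close> be read as the scalar \<open>c\<close> of
  \<open>slice_one_plus_powr\<close>.\<close>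

lemma mconst_numeral: "mconst (numeral k) = numeral k"
  by (induction k) (simp_all only: numeral.simps mconst_1 mconst_add)

lemma sum_mconst_mult: "(\<Sum>i\<in>A. mconst (c i) * f) = mconst (\<Sum>i\<in>A. c i) * f"
  by (rule mfps_eqI) (simp add: mcoeff_sum sum_distrib_right)

section \<open>Binomial series with arbitrary exponent\<close>

lemma mcoeff_one_plus_powr:
  fixes L :: "'a::field_char_0 mfps"
  assumes "mcoeff L 0 = 0" "total_degree m \<le> D"
  shows "mcoeff (one_plus_powr L a) m = (\<Sum>j\<le>D. (a gchoose j) * mcoeff (L ^ j) m)"
proof -
  have "mcoeff (one_plus_powr L a) m = Sum_any (\<lambda>j. (a gchoose j) * mcoeff (L ^ j) m)"
    by (simp add: one_plus_powr_def Abs_mfps_inverse)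
  also have "\<dots> = (\<Sum>j\<le>D. (a gchoose j) * mcoeff (L ^ j) m)"
  proof (rule Sum_any.expand_superset)
    show "{j. (a gchoose j) * mcoeff (L ^ j) m \<noteq> 0} \<subseteq> {..D}"
      using mcoeff_power_eq_0[OF assms(1), of m] assms(2)
      by (force simp: not_le[symmetric])
  qed simp
  finally show ?thesis .
qed

lemma one_plus_powr_zero: "one_plus_powr 0 a = 1"
proof (rule mfps_eqI)
  fix m
  have "(\<Sum>j\<le>total_degree m. (a gchoose j) * mcoeff (0 ^ j) m) =
      (\<Sum>j\<in>{0}. (a gchoose j) * mcoeff (0 ^ j) m)"
    by (rule sum.mono_neutral_right) (auto simp: power_0_left)
  then show "mcoeff (one_plus_powr 0 a) m = mcoeff 1 m"
    by (simp add: mcoeff_one_plus_powr[of 0 m, OF _ order.refl])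
qed

text \<open>Comparing coefficients of each power of \<open>L\<close> reduces this to the Vandermonde
  convolution. One truncation bound \<open>D\<close> serves both factors, because each part of a
  splitting of \<open>m\<close> has total degree at most that of \<open>m\<close>.\<close>

lemma one_plus_powr_add:
  fixes L :: "'a::field_char_0 mfps"
  assumes L: "mcoeff L 0 = 0"
  shows "one_plus_powr L a * one_plus_powr L c = one_plus_powr L (a + c)"
proof (rule mfps_eqI)
  fix m
  define D where "D = total_degree m"
  let ?P = "{p. fst p + snd p = m}"
  let ?t = "\<lambda>j k. (a gchoose j) * (c gchoose k) * mcoeff (L ^ (j + k)) m"
  have "mcoeff (one_plus_powr L a * one_plus_powr L c) m =
      (\<Sum>p\<in>?P. mcoeff (one_plus_powr L a) (fst p) * mcoeff (one_plus_powr L c) (snd p))"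
    by (simp add: times_mfps.rep_eq)
  also have "\<dots> = (\<Sum>p\<in>?P. (\<Sum>j\<le>D. (a gchoose j) * mcoeff (L ^ j) (fst p)) *
      (\<Sum>k\<le>D. (c gchoose k) * mcoeff (L ^ k) (snd p)))"
    by (intro sum.cong refl arg_cong2[where f = "(*)"] mcoeff_one_plus_powr[OF L])
      (auto simp: D_def total_degree_add)
  also have "\<dots> = (\<Sum>p\<in>?P. \<Sum>j\<le>D. \<Sum>k\<le>D. (a gchoose j) * (c gchoose k) *
      (mcoeff (L ^ j) (fst p) * mcoeff (L ^ k) (snd p)))"
    by (simp add: sum_product mult_ac)
  also have "\<dots> = (\<Sum>j\<le>D. \<Sum>k\<le>D. \<Sum>p\<in>?P. (a gchoose j) * (c gchoose k) *
      (mcoeff (L ^ j) (fst p) * mcoeff (L ^ k) (snd p)))"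
    by (subst sum.swap, intro sum.cong refl, rule sum.swap)
  also have "\<dots> = (\<Sum>j\<le>D. \<Sum>k\<le>D. ?t j k)"
    by (simp add: power_add times_mfps.rep_eq sum_distrib_left)
  also have "\<dots> = (\<Sum>(j, k)\<in>{..D} \<times> {..D}. ?t j k)"
    by (simp add: sum.cartesian_product)
  \<comment> \<open>Cutting the square down to a triangle loses nothing: \<open>L ^ (j + k)\<close>
    has no monomial of total degree below \<open>j + k\<close>.\<close>
  also have "\<dots> = (\<Sum>(j, k)\<in>{(j, k). j + k \<le> D}. ?t j k)"
  proof (rule sum.mono_neutral_right)
    show "\<forall>p\<in>{..D} \<times> {..D} - {(j, k). j + k \<le> D}. (case p of (j, k) \<Rightarrow> ?t j k) = 0"
    proof
      fix p assume "p \<in> {..D} \<times> {..D} - {(j, k). j + k \<le> D}"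
      then have "D < fst p + snd p" by auto
      then have "mcoeff (L ^ (fst p + snd p)) m = 0"
        unfolding D_def by (rule mcoeff_power_eq_0[OF L])
      then show "(case p of (j, k) \<Rightarrow> ?t j k) = 0"
        by (simp add: split_def)
    qed
  qed auto
  also have "\<dots> = (\<Sum>s\<le>D. \<Sum>j\<le>s. ?t j (s - j))"
    by (rule sum.triangle_reindex_eq)
  also have "\<dots> = (\<Sum>s\<le>D. ((a + c) gchoose s) * mcoeff (L ^ s) m)"
    by (intro sum.cong refl) (simp flip: gbinomial_Vandermonde add: sum_distrib_right atMost_atLeast0)
  also have "\<dots> = mcoeff (one_plus_powr L (a + c)) m"
    by (simp add: mcoeff_one_plus_powr[OF L order.refl] D_def)
  finally show "mcoeff (one_plus_powr L a * one_plus_powr L c) m = \<dots>" .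
qed

section \<open>Extracting the coefficient of a power of one variable\<close>

text \<open>This is $[x_i^n] f$ as a series in the other variables. It vanishes at every monomial
  containing $x_i$, so it stays in the same type and slices can be iterated.\<close>

lift_definition slice :: "nat \<Rightarrow> nat \<Rightarrow> 'a mfps \<Rightarrow> 'a::comm_ring_1 mfps"
  is "\<lambda>i n f m. if Poly_Mapping.lookup m i = 0 then f (m + Poly_Mapping.single i n) else 0" .

lift_definition free_of :: "nat \<Rightarrow> 'a::comm_ring_1 mfps \<Rightarrow> bool"
  is "\<lambda>i f. \<forall>m. Poly_Mapping.lookup m i \<noteq> 0 \<longrightarrow> f m = 0" .

lemma slice_add: "slice i n (f + g) = slice i n f + slice i n g"
  by transfer (auto simp: fun_eq_iff)

lemma slice_mconst_mult: "slice i n (mconst c * f) = mconst c * slice i n f"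
  by (rule mfps_eqI) (simp add: slice.rep_eq)

lemma slice_free_of:
  assumes "free_of i f"
  shows "slice i n f = (if n = 0 then f else 0)"
  using assms by transfer (auto simp: fun_eq_iff lookup_add)

lemma slice_mvar: "slice i n (mvar i) = (if n = 1 then 1 else 0)"
proof (rule mfps_eqI)
  fix m
  have "(m + Poly_Mapping.single i n = Poly_Mapping.single i 1) \<longleftrightarrow> m = 0 \<and> n = 1"
    if "Poly_Mapping.lookup m i = 0"
  proof
    assume *: "m + Poly_Mapping.single i n = Poly_Mapping.single i 1"
    have "n = 1"
      using arg_cong[OF *, of "\<lambda>p. Poly_Mapping.lookup p i"] that by (simp add: lookup_add)
    then show "m = 0 \<and> n = 1" using * by simp
  qed simp
  then show "mcoeff (slice i n (mvar i)) m = mcoeff (if n = 1 then 1 else 0) m"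
    by (auto simp: slice.rep_eq mvar.rep_eq one_mfps.rep_eq)
qed

lemma slice_mult:
  "slice i n (f * g) = (\<Sum>j\<le>n. slice i j f * slice i (n - j) g)"
proof (rule mfps_eqI)
  fix m :: "nat \<Rightarrow>\<^sub>0 nat"
  let ?s = "\<lambda>j. Poly_Mapping.single i j"
  let ?l = "\<lambda>p :: nat \<Rightarrow>\<^sub>0 nat. Poly_Mapping.lookup p i"
  show "mcoeff (slice i n (f * g)) m = mcoeff (\<Sum>j\<le>n. slice i j f * slice i (n - j) g) m"
  proof (cases "?l m = 0")
    \<comment> \<open>Both sides are 0: in every splitting of \<open>m\<close> one of the two parts
      contains $x_i$.\<close>
    case False
    then have "mcoeff (slice i j f) (fst p) * mcoeff (slice i (n - j) g) (snd p) = 0"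
      if "fst p + snd p = m" for p j
      using that by (auto simp: slice.rep_eq lookup_add)
    then show ?thesis
      using False by (simp add: mcoeff_sum times_mfps.rep_eq slice.rep_eq[of i n])
  next
    case True
    have z: "?l (fst p) = 0" "?l (snd p) = 0" if "fst p + snd p = m" for p
      using that True by (auto simp: lookup_add)
    \<comment> \<open>Subtraction of exponents is truncated; here exactly the $x_i$-part is removed,
      so adding it back restores \<open>p\<close>.\<close>
    have up: "p - ?s (?l p) + ?s (?l p) = p" for p
      by (rule poly_mapping_eqI) (auto simp: lookup_add lookup_minus lookup_single when_def)
    have "mcoeff (\<Sum>j\<le>n. slice i j f * slice i (n - j) g) m =
        (\<Sum>j\<le>n. \<Sum>p | fst p + snd p = m. mcoeff f (fst p + ?s j) * mcoeff g (snd p + ?s (n - j)))"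
      by (auto simp: mcoeff_sum times_mfps.rep_eq slice.rep_eq z intro!: sum.cong)
    also have "\<dots> = (\<Sum>(j, p)\<in>{..n} \<times> {p. fst p + snd p = m}.
        mcoeff f (fst p + ?s j) * mcoeff g (snd p + ?s (n - j)))"
      by (simp add: sum.cartesian_product)
    also have "\<dots> = (\<Sum>p | fst p + snd p = m + ?s n. mcoeff f (fst p) * mcoeff g (snd p))"
    proof (rule sum.reindex_bij_witness[of _
          "\<lambda>p. (?l (fst p), (fst p - ?s (?l (fst p)), snd p - ?s (?l (snd p))))"
          "\<lambda>(j, p). (fst p + ?s j, snd p + ?s (n - j))"], goal_cases)
      case (1 a)
      then show ?case
        using z by (auto simp: lookup_add)
    next
      case (2 a)
      then have "fst (snd a) + snd (snd a) = m" "fst a \<le> n" by auto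
      then show ?case
        by (auto simp: split_def add_ac simp flip: single_add)
    next
      case (3 p)
      then have *: "fst p + snd p = m + ?s n" by simp
      have "?l (fst p + snd p) = ?l (m + ?s n)"
        by (simp only: *)
      then have "n - ?l (fst p) = ?l (snd p)"
        using True by (simp add: lookup_add)
      then show ?case
        by (simp add: up)
    next
      case (4 p)
      then have *: "fst p + snd p = m + ?s n" by simp
      have "?l (fst p + snd p) = ?l (m + ?s n)"
        by (simp only: *)
      then have l: "?l (fst p) + ?l (snd p) = n"
        using True by (simp add: lookup_add)
      have "Poly_Mapping.lookup (fst p - ?s (?l (fst p)) + (snd p - ?s (?l (snd p)))) k
          = Poly_Mapping.lookup m k" for k
        using True l arg_cong[OF *, of "\<lambda>p. Poly_Mapping.lookup p k"]
        by (auto simp: lookup_add lookup_minus lookup_single when_def)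
      then show ?case
        using l by (auto intro!: poly_mapping_eqI)
    qed auto
    finally show ?thesis
      using True by (simp add: slice.rep_eq times_mfps.rep_eq)
  qed
qed

lemma slice_mult_free_of:
  assumes "free_of i f"
  shows "slice i n (f * g) = f * slice i n g"
proof -
  have "slice i n (f * g) = (\<Sum>j\<le>n. if j = 0 then f * slice i (n - j) g else 0)"
    unfolding slice_mult by (intro sum.cong) (auto simp: slice_free_of[OF assms])
  then show ?thesis by simp
qed

lemma slice_mvar_mult: "slice i n (mvar i * f) = (if n = 0 then 0 else slice i (n - 1) f)"
proof -
  have "slice i n (mvar i * f) = (\<Sum>j\<le>n. if j = 1 then slice i (n - j) f else 0)"
    unfolding slice_mult by (intro sum.cong) (auto simp: slice_mvar)
  then show ?thesis by (cases n) auto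
qed

lemma free_of_one: "free_of i 1"
  by transfer auto

lemma free_of_mconst: "free_of i (mconst c)"
  by transfer auto

lemma free_of_zero: "free_of i 0"
  by transfer auto

lemma free_of_add: "free_of i f \<Longrightarrow> free_of i g \<Longrightarrow> free_of i (f + g)"
  by transfer auto

lemma free_of_mvar: "i \<noteq> k \<Longrightarrow> free_of i (mvar k)"
  by transfer (auto simp: lookup_single)

lemma free_of_mult: "free_of i f \<Longrightarrow> free_of i g \<Longrightarrow> free_of i (f * g)"
  unfolding free_of.rep_eq times_mfps.rep_eq
  by (auto intro!: sum.neutral simp: lookup_add)

lemma free_of_power: "free_of i f \<Longrightarrow> free_of i (f ^ n)"
  by (induction n) (auto simp: free_of_one free_of_mult)

lemma free_of_sum: "(\<And>k. k \<in> A \<Longrightarrow> free_of i (f k)) \<Longrightarrow> free_of i (\<Sum>k\<in>A. f k)"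
  by (induction A rule: infinite_finite_induct) (auto simp: free_of_zero free_of_add)

lemma free_of_prod: "(\<And>k. k \<in> A \<Longrightarrow> free_of i (f k)) \<Longrightarrow> free_of i (\<Prod>k\<in>A. f k)"
  by (induction A rule: infinite_finite_induct) (auto simp: free_of_one free_of_mult)

lemma free_of_one_plus_powr:
  assumes "free_of i L"
  shows "free_of i (one_plus_powr L a)"
  using free_of_power[OF assms]
  by (auto simp: free_of.rep_eq one_plus_powr_def Abs_mfps_inverse)

lemma mcoeff_mvar_0: "mcoeff (mvar i) 0 = 0"
proof -
  have "0 \<noteq> Poly_Mapping.single i (1 :: nat)"
    by (metis lookup_single_eq lookup_zero zero_neq_one)
  then show ?thesis by (simp add: mvar.rep_eq)
qed

text \<open>The binomial theorem in $x_i$. For \<open>n > j\<close> the truncated exponent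
  \<open>j - n\<close> is harmless, since \<open>j choose n\<close> is then 0.\<close>

lemma slice_power_linear:
  assumes "free_of i L"
  shows "slice i n ((L + mconst c * mvar i) ^ j) = mconst (of_nat (j choose n) * c ^ n) * L ^ (j - n)"
proof (induction j arbitrary: n)
  case 0
  show ?case
    by (cases n) (auto simp: slice_free_of[OF free_of_one] mconst_0 mconst_1)
next
  case (Suc j)
  note IH = Suc
  have "slice i n ((L + mconst c * mvar i) ^ Suc j) =
      L * slice i n ((L + mconst c * mvar i) ^ j) +
      (if n = 0 then 0 else mconst c * slice i (n - 1) ((L + mconst c * mvar i) ^ j))"
    by (simp add: distrib_right slice_add slice_mult_free_of[OF assms] slice_mvar_mult
        slice_mconst_mult mult.assoc)
  also have "\<dots> = mconst (of_nat (Suc j choose n) * c ^ n) * L ^ (Suc j - n)"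
  proof (cases n)
    case 0
    then show ?thesis by (simp add: IH mult.left_commute)
  next
    case [simp]: (Suc k)
    have "L * (mconst (of_nat (j choose n) * c ^ n) * L ^ (j - n)) =
        mconst (of_nat (j choose n) * c ^ n) * L ^ (j - k)"
    proof (cases "n \<le> j")
      case True
      then have "j - k = Suc (j - n)" by simp
      then show ?thesis by (simp only: power_Suc mult_ac)
    qed (simp add: mconst_0 binomial_eq_0)
    then show ?thesis
      by (simp add: IH mconst_mult_mconst) (simp add: mconst_add algebra_simps)
  qed
  finally show ?case .
qed

lemma slice_one_plus_powr:
  fixes L :: "'a::field_char_0 mfps"
  assumes "free_of i L" and L: "mcoeff L 0 = 0"
  shows "slice i n (one_plus_powr (L + mconst c * mvar i) a) =
    mconst ((a gchoose n) * c ^ n) * one_plus_powr L (a - of_nat n)"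
proof (rule mfps_eqI)
  fix m
  let ?M = "L + mconst c * mvar i"
  define D where "D = total_degree m"
  have M: "mcoeff ?M 0 = 0"
    using L by (simp add: mcoeff_mvar_0)
  have sl: "mcoeff (?M ^ j) (m + Poly_Mapping.single i n) =
      of_nat (j choose n) * c ^ n * mcoeff (L ^ (j - n)) m" if "Poly_Mapping.lookup m i = 0" for j
    using arg_cong[OF slice_power_linear[OF assms(1), of n c j], of "\<lambda>f. mcoeff f m"] that
    by (simp add: slice.rep_eq)
  show "mcoeff (slice i n (one_plus_powr ?M a)) m =
      mcoeff (mconst ((a gchoose n) * c ^ n) * one_plus_powr L (a - of_nat n)) m"
  proof (cases "Poly_Mapping.lookup m i = 0")
    case False
    then show ?thesis
      using free_of_one_plus_powr[OF assms(1), of "a - of_nat n"]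
      by (simp add: slice.rep_eq free_of.rep_eq)
  next
    case True
    \<comment> \<open>The bound \<open>D + n\<close> becomes \<open>D\<close> after the shift of
      \<open>j\<close> by \<open>n\<close>, which is the right truncation for \<open>m\<close>
      itself.\<close>
    have td: "total_degree (m + Poly_Mapping.single i n) \<le> D + n"
      by (simp add: D_def total_degree_add) (simp add: total_degree_def)
    have "mcoeff (slice i n (one_plus_powr ?M a)) m =
        (\<Sum>j\<le>D + n. (a gchoose j) * (of_nat (j choose n) * c ^ n * mcoeff (L ^ (j - n)) m))"
      using True by (simp add: slice.rep_eq mcoeff_one_plus_powr[OF M td] sl)
    also have "\<dots> = (\<Sum>j\<in>{n..D + n}. (a gchoose j) * (of_nat (j choose n) * c ^ n * mcoeff (L ^ (j - n)) m))"
      by (rule sum.mono_neutral_right) auto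
    also have "\<dots> = (\<Sum>j\<le>D. (a gchoose (j + n)) * (of_nat ((j + n) choose n) * c ^ n * mcoeff (L ^ j) m))"
      by (rule sum.reindex_bij_witness[of _ "\<lambda>j. j + n" "\<lambda>j. j - n"]) auto
    also have "\<dots> = (\<Sum>j\<le>D. (a gchoose n) * c ^ n * ((a - of_nat n gchoose j) * mcoeff (L ^ j) m))"
    proof (rule sum.cong)
      fix j
      have "(a gchoose (j + n)) * of_nat ((j + n) choose n) = (a gchoose n) * (a - of_nat n gchoose j)"
        using gbinomial_trinomial_revision[of n "j + n" a] by (simp add: binomial_gbinomial)
      then show "(a gchoose (j + n)) * (of_nat ((j + n) choose n) * c ^ n * mcoeff (L ^ j) m) =
          (a gchoose n) * c ^ n * ((a - of_nat n gchoose j) * mcoeff (L ^ j) m)"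
        by (metis (no_types, opaque_lifting) mult.assoc mult.commute)
    qed simp
    also have "\<dots> = mcoeff (mconst ((a gchoose n) * c ^ n) * one_plus_powr L (a - of_nat n)) m"
      by (simp add: mcoeff_one_plus_powr[OF L order.refl] D_def sum_distrib_left)
    finally show ?thesis .
  qed
qed

section \<open>The one-variable coefficient of $(1+2x)^b (1+x)^{-n-1}$\<close>

lemma fps_nth_one_plus_const_X_power:
  "((1 + fps_const c * fps_X) ^ k) $ j = of_nat (k choose j) * (c :: 'a::comm_ring_1) ^ j"
proof (induction k arbitrary: j)
  case 0
  show ?case by (cases j) auto
next
  case (Suc k)
  note IH = Suc
  show ?case
  proof (cases j)
    case 0
    then show ?thesis by (simp add: Suc)
  next
    case (Suc i)
    then show ?thesis
      by (simp add: IH distrib_right mult.assoc)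
  qed
qed

text \<open>The left side is $[x^n] (1+2x)^{2m+1} (1+x)^{-n-1}$. Raising $m$ by one multiplies by $1
  + 4x(1+x)$, which adds 4 times the value at $(m, n-1)$; up to the factor $4^n$ this is Pascal's
  rule.\<close>

lemma sum_gbinomial_double_odd:
  fixes m n :: nat
  shows "(\<Sum>j\<le>n. (of_nat (2 * m + 1) gchoose j) * 2 ^ j * (- of_nat n - 1 gchoose (n - j))) =
    4 ^ n * ((of_nat m :: 'a::field_char_0) gchoose n)"
proof -
  let ?F = "\<lambda>m. (1 + fps_const (2::'a) * fps_X) ^ (2 * m + 1)"
  let ?B = "\<lambda>n. fps_binomial (- of_nat n - 1 :: 'a)"
  \<comment> \<open>The factor $1+x$ produces exactly the exponent that belongs to the index one
    lower, which closes the recursion.\<close>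
  have B: "(1 + fps_X) * ?B (Suc n) = ?B n" for n
  proof -
    have "1 + (- of_nat (Suc n) - 1) = (- of_nat n - 1 :: 'a)" by simp
    then show ?thesis
      by (metis fps_binomial_add_mult fps_binomial_1)
  qed
  have sq: "(1 + fps_const (2::'a) * fps_X)\<^sup>2 = 1 + fps_const 4 * fps_X * (1 + fps_X)"
    by (simp add: power2_eq_square algebra_simps fps_const_mult[symmetric] numeral_fps_const
        del: fps_const_mult)
      (simp flip: mult.assoc)
  have "(?F m * ?B n) $ n = 4 ^ n * ((of_nat m :: 'a) gchoose n)"
  proof (induction m arbitrary: n)
    case 0
    show ?case
    proof (cases n)
      case (Suc k)
      \<comment> \<open>For $n = k+1$ consecutive binomials have ratio $-(n+1+k)/(k+1) = -2$, so the
        two terms contributed by $1+2x$ cancel.\<close>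
      have "of_nat (Suc k) * ((- of_nat n - 1 :: 'a) gchoose Suc k) =
          (- of_nat n - 1 - of_nat k) * ((- of_nat n - 1) gchoose k)"
        using gbinomial_absorb_comp[of "- of_nat n - 1 :: 'a" k] gbinomial_absorption[of k "- of_nat n - 1 :: 'a"]
        by simp
      also have "\<dots> = of_nat (Suc k) * (- 2 * ((- of_nat n - 1 :: 'a) gchoose k))"
        using Suc by (simp add: algebra_simps)
      finally have "((- of_nat n - 1 :: 'a) gchoose Suc k) = - 2 * ((- of_nat n - 1 :: 'a) gchoose k)"
        by (simp only: mult_cancel_left of_nat_eq_0_iff) simp
      then show ?thesis
        using Suc by (simp add: distrib_right mult.assoc)
    qed simp
  next
    case (Suc m)
    show ?case
    proof (cases n)
      case 0
      then show ?thesis by (simp add: fps_nth_power_0)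
    next
      case [simp]: (Suc k)
      have "?F (Suc m) = ?F m * (1 + fps_const 4 * fps_X * (1 + fps_X))"
        unfolding sq[symmetric] by (simp flip: power_add)
      then have "?F (Suc m) * ?B n = ?F m * ?B n + fps_const 4 * (fps_X * (?F m * ((1 + fps_X) * ?B n)))"
        by (simp only: distrib_left distrib_right mult_1_left mult_1_right mult_ac)
      also have "\<dots> = ?F m * ?B n + fps_const 4 * (fps_X * (?F m * ?B k))"
        by (simp only: B Suc)
      finally have "(?F (Suc m) * ?B n) $ n = (?F m * ?B n) $ n + 4 * (?F m * ?B k) $ k"
        by (simp del: power_Suc)
      also have "\<dots> = 4 ^ n * ((of_nat m :: 'a) gchoose n) + 4 * (4 ^ k * ((of_nat m :: 'a) gchoose k))"
        by (simp only: Suc.IH)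
      also have "\<dots> = 4 ^ n * ((of_nat (Suc m) :: 'a) gchoose n)"
        using gbinomial_Suc_Suc[of "of_nat m :: 'a" k] by (simp add: algebra_simps)
      finally show ?thesis .
    qed
  qed
  moreover have "(?F m * ?B n) $ n = (\<Sum>j\<le>n. (of_nat (2 * m + 1) gchoose j) * 2 ^ j *
      (- of_nat n - 1 gchoose (n - j)))"
    unfolding fps_mult_nth fps_nth_one_plus_const_X_power binomial_gbinomial
    by (simp only: fps_binomial_nth atMost_atLeast0)
  ultimately show ?thesis by simp
qed

definition gbinomial_poly :: "nat \<Rightarrow> 'a::field_char_0 poly"
  where "gbinomial_poly j = smult (1 / fact j) (\<Prod>i<j. [:- of_nat i, 1:])"

lemma poly_gbinomial_poly: "poly (gbinomial_poly j) x = x gchoose j"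
  by (simp add: gbinomial_poly_def poly_prod gbinomial_prod_rev atLeast0LessThan)

text \<open>Both sides are polynomials in \<open>b\<close>, so it suffices that they agree for odd natural numbers,
  where $(1+2x)^2 = 1 + 4x(1+x)$ gives a recursion for $[x^n] (1+2x)^b(1+x)^{-n-1}$.\<close>

lemma sum_gbinomial_double:
  fixes b :: "'a::field_char_0"
  shows "(\<Sum>j\<le>n. (b gchoose j) * 2 ^ j * (- of_nat n - 1 gchoose (n - j))) =
    4 ^ n * ((b - 1) / 2 gchoose n)"
proof -
  let ?P = "(\<Sum>j\<le>n. smult (2 ^ j * (- of_nat n - 1 gchoose (n - j))) (gbinomial_poly j)) -
    smult (4 ^ n) (pcompose (gbinomial_poly n) [:- 1 / 2, 1 / 2:]) :: 'a poly"
  have P: "poly ?P x = (\<Sum>j\<le>n. (x gchoose j) * 2 ^ j * (- of_nat n - 1 gchoose (n - j))) -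
      4 ^ n * ((x - 1) / 2 gchoose n)" for x
  proof -
    have "- 1 / 2 + x * (1 / 2) = (x - 1) / 2"
      by (simp add: field_simps)
    then show ?thesis
      by (simp add: poly_sum poly_pcompose poly_gbinomial_poly mult_ac diff_divide_distrib)
  qed
  have "poly ?P (of_nat (2 * m + 1)) = 0" for m
    unfolding P sum_gbinomial_double_odd by simp
  then have "range (\<lambda>m. of_nat (2 * m + 1)) \<subseteq> {x. poly ?P x = 0}"
    by blast
  moreover have "infinite (range (\<lambda>m. of_nat (2 * m + 1) :: 'a))"
    by (rule range_inj_infinite) (simp add: inj_on_def del: of_nat_add of_nat_mult)
  ultimately have "?P = 0"
    using poly_roots_finite[of ?P] finite_subset by blast
  then show ?thesis
    using P[of b] by simp
qed

section \<open>Diagonal coefficients, one variable at a time\<close>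

lemma mcoeff_sum_mvar_0: "mcoeff (\<Sum>i\<in>A. mvar i) 0 = 0"
  by (simp add: mcoeff_sum mcoeff_mvar_0)

lemma free_of_sum_mvar: "k \<notin> A \<Longrightarrow> free_of k (\<Sum>i\<in>A. mvar i)"
  by (auto intro!: free_of_sum free_of_mvar)

lemma mcoeff_diag_Suc:
  "mcoeff f (\<Sum>i = 1..Suc k. Poly_Mapping.single i n) =
    mcoeff (slice (Suc k) n f) (\<Sum>i = 1..k. Poly_Mapping.single i n)"
proof -
  have "Poly_Mapping.lookup (\<Sum>i = 1..k. Poly_Mapping.single i n) (Suc k) = 0"
    by (auto simp: lookup_sum lookup_single when_def)
  then show ?thesis
    by (simp add: slice.rep_eq)
qed

lemma slice_one_plus_powr_sum_mvar:
  fixes a :: "'a::field_char_0"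
  shows "slice (Suc k) n (one_plus_powr (\<Sum>i = 1..Suc k. mvar i) a) =
    mconst (a gchoose n) * one_plus_powr (\<Sum>i = 1..k. mvar i) (a - of_nat n)"
  using slice_one_plus_powr[of "Suc k" "\<Sum>i = 1..k. mvar i" n 1 a]
  by (simp add: free_of_sum_mvar mcoeff_sum_mvar_0 mconst_1)

lemma mcoeff_diag_prod_one_plus_powr:
  fixes bs :: "nat \<Rightarrow> 'a::field_char_0"
  shows "mcoeff ((\<Prod>l = 1..k. one_plus_powr (\<Sum>i = 1..l. mvar i) (bs l)) *
      one_plus_powr (\<Sum>i = 1..k. mvar i) e) (\<Sum>i = 1..k. Poly_Mapping.single i n) =
    (\<Prod>l = 1..k. (e + (\<Sum>i = l..k. bs i) - of_nat ((k - l) * n)) gchoose n)"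
proof (induction k arbitrary: e)
  case 0
  show ?case by (simp add: one_plus_powr_zero one_mfps.rep_eq)
next
  case (Suc k)
  let ?S = "\<lambda>k. (\<Sum>i = 1..k. mvar i) :: 'a mfps"
  let ?Q = "\<Prod>l = 1..k. one_plus_powr (?S l) (bs l)"
  let ?e = "bs (Suc k) + e"
  have free: "free_of (Suc k) ?Q"
    by (intro free_of_prod free_of_one_plus_powr free_of_sum_mvar) auto
  have "(\<Prod>l = 1..Suc k. one_plus_powr (?S l) (bs l)) * one_plus_powr (?S (Suc k)) e =
      ?Q * (one_plus_powr (?S (Suc k)) (bs (Suc k)) * one_plus_powr (?S (Suc k)) e)"
    by (simp add: mult.assoc)
  also have "\<dots> = ?Q * one_plus_powr (?S (Suc k)) ?e"
    by (simp only: one_plus_powr_add[OF mcoeff_sum_mvar_0])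
  finally have "slice (Suc k) n ((\<Prod>l = 1..Suc k. one_plus_powr (?S l) (bs l)) *
        one_plus_powr (?S (Suc k)) e) =
      mconst (?e gchoose n) * (?Q * one_plus_powr (?S k) (?e - of_nat n))"
    by (simp only: slice_mult_free_of[OF free] slice_one_plus_powr_sum_mvar mult.left_commute)
  then have "mcoeff ((\<Prod>l = 1..Suc k. one_plus_powr (?S l) (bs l)) * one_plus_powr (?S (Suc k)) e)
        (\<Sum>i = 1..Suc k. Poly_Mapping.single i n) =
      (?e gchoose n) *
        (\<Prod>l = 1..k. (?e - of_nat n + (\<Sum>i = l..k. bs i) - of_nat ((k - l) * n)) gchoose n)"
    by (simp only: mcoeff_diag_Suc mcoeff_mconst_mult Suc.IH)
  also have "(\<Prod>l = 1..k. (?e - of_nat n + (\<Sum>i = l..k. bs i) - of_nat ((k - l) * n)) gchoose n) =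
      (\<Prod>l = 1..k. (e + (\<Sum>i = l..Suc k. bs i) - of_nat ((Suc k - l) * n)) gchoose n)"
    by (intro prod.cong refl arg_cong2[where f = "(gchoose)"]) (simp add: Suc_diff_le distrib_right)
  finally show ?case
    by (simp add: algebra_simps)
qed

text \<open>Here $N = k+2$. The variables $x_N$ and $x_{N-1}$ are removed by hand, which leaves the
  product of the preceding lemma with $e = b-1-2n$.\<close>

lemma mcoeff_diag_R_series:
  fixes bs :: "nat \<Rightarrow> rat"
  assumes "bs (Suc k) + bs (Suc (Suc k)) = - 1"
  shows "mcoeff (one_plus_powr ((\<Sum>i = 1..k. mvar i) + 2 * mvar (Suc k)) b * R_series (Suc (Suc k)) bs)
      (\<Sum>i = 1..Suc (Suc k). Poly_Mapping.single i n) =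
    (bs (Suc (Suc k)) gchoose n) * (4 ^ n * ((b - 1) / 2 gchoose n)) *
    (\<Prod>l = 1..k. (b - 1 - 2 * of_nat n + (\<Sum>i = l..k. bs i) - of_nat ((k - l) * n)) gchoose n)"
proof -
  let ?S = "\<lambda>k. (\<Sum>i = 1..k. mvar i) :: rat mfps"
  let ?Q = "\<Prod>l = 1..k. one_plus_powr (?S l) (bs l)"
  let ?T = "one_plus_powr (?S k + 2 * mvar (Suc k)) b"
  let ?bN = "bs (Suc (Suc k))"
  have free1: "free_of (Suc (Suc k)) (?T * ?Q * one_plus_powr (?S (Suc k)) (bs (Suc k)))"
    unfolding mconst_numeral[symmetric]
    by (intro free_of_mult free_of_prod free_of_one_plus_powr free_of_sum_mvar free_of_add
        free_of_mvar free_of_mconst) auto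
  have free2: "free_of (Suc k) ?Q"
    by (intro free_of_prod free_of_one_plus_powr free_of_sum_mvar) auto
  have T: "slice (Suc k) j ?T = mconst ((b gchoose j) * 2 ^ j) * one_plus_powr (?S k) (b - of_nat j)" for j
    using slice_one_plus_powr[of "Suc k" "?S k" j 2 b]
    by (simp add: free_of_sum_mvar mcoeff_sum_mvar_0 mconst_numeral)
  have "?T * R_series (Suc (Suc k)) bs =
      (?T * ?Q * one_plus_powr (?S (Suc k)) (bs (Suc k))) * one_plus_powr (?S (Suc (Suc k))) ?bN"
    unfolding R_series_def by (simp add: mult.assoc)
  then have "slice (Suc (Suc k)) n (?T * R_series (Suc (Suc k)) bs) =
      (?T * ?Q * one_plus_powr (?S (Suc k)) (bs (Suc k))) *
      (mconst (?bN gchoose n) * one_plus_powr (?S (Suc k)) (?bN - of_nat n))"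
    by (simp only: slice_mult_free_of[OF free1] slice_one_plus_powr_sum_mvar)
  also have "\<dots> = mconst (?bN gchoose n) * (?Q * (?T *
      (one_plus_powr (?S (Suc k)) (bs (Suc k)) * one_plus_powr (?S (Suc k)) (?bN - of_nat n))))"
    by (simp only: mult_ac)
  also have "\<dots> = mconst (?bN gchoose n) * (?Q * (?T * one_plus_powr (?S (Suc k)) (- of_nat n - 1)))"
  proof -
    have "bs (Suc k) + (?bN - of_nat n) = - of_nat n - 1"
      using assms by simp
    then show ?thesis
      by (simp only: one_plus_powr_add[OF mcoeff_sum_mvar_0])
  qed
  finally have 1: "slice (Suc (Suc k)) n (?T * R_series (Suc (Suc k)) bs) = \<dots>" .
  have "slice (Suc k) n (?T * one_plus_powr (?S (Suc k)) (- of_nat n - 1)) =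
      (\<Sum>j\<le>n. mconst ((b gchoose j) * 2 ^ j) * one_plus_powr (?S k) (b - of_nat j) *
        (mconst (- of_nat n - 1 gchoose (n - j)) *
          one_plus_powr (?S k) (- of_nat n - 1 - of_nat (n - j))))"
    by (simp only: slice_mult T slice_one_plus_powr_sum_mvar)
  also have "\<dots> = (\<Sum>j\<le>n. mconst ((b gchoose j) * 2 ^ j * (- of_nat n - 1 gchoose (n - j))) *
      one_plus_powr (?S k) (b - 1 - 2 * of_nat n))"
  proof (rule sum.cong)
    fix j assume "j \<in> {..n}"
    \<comment> \<open>The exponent left on $S_k$ does not depend on \<open>j\<close>, so the power
      of $S_k$ factors out of the sum.\<close>
    then have e: "b - of_nat j + (- of_nat n - 1 - of_nat (n - j)) = b - 1 - 2 * of_nat n"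
      by (simp add: of_nat_diff)
    have "mconst ((b gchoose j) * 2 ^ j) * one_plus_powr (?S k) (b - of_nat j) *
        (mconst (- of_nat n - 1 gchoose (n - j)) *
          one_plus_powr (?S k) (- of_nat n - 1 - of_nat (n - j))) =
        mconst ((b gchoose j) * 2 ^ j) * (mconst (- of_nat n - 1 gchoose (n - j)) *
        (one_plus_powr (?S k) (b - of_nat j) *
          one_plus_powr (?S k) (- of_nat n - 1 - of_nat (n - j))))"
      by (simp only: mult_ac)
    then show "mconst ((b gchoose j) * 2 ^ j) * one_plus_powr (?S k) (b - of_nat j) *
        (mconst (- of_nat n - 1 gchoose (n - j)) *
          one_plus_powr (?S k) (- of_nat n - 1 - of_nat (n - j))) =
        mconst ((b gchoose j) * 2 ^ j * (- of_nat n - 1 gchoose (n - j))) *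
          one_plus_powr (?S k) (b - 1 - 2 * of_nat n)"
      by (simp only: one_plus_powr_add[OF mcoeff_sum_mvar_0] e mconst_mult_mconst)
  qed simp
  also have "\<dots> = mconst (4 ^ n * ((b - 1) / 2 gchoose n)) * one_plus_powr (?S k) (b - 1 - 2 * of_nat n)"
    by (simp only: sum_mconst_mult sum_gbinomial_double)
  finally have 2: "slice (Suc k) n (?T * one_plus_powr (?S (Suc k)) (- of_nat n - 1)) = \<dots>" .
  have 3: "?Q * (mconst c * f) = mconst c * (?Q * f)" for c f
    by (simp only: mult_ac)
  show ?thesis
    unfolding mcoeff_diag_Suc[where k = "Suc k"] 1 slice_mconst_mult mcoeff_mconst_mult mcoeff_diag_Suc[where k = k]
      slice_mult_free_of[OF free2] 2 3 mcoeff_diag_prod_one_plus_powr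
    by (simp only: mult.assoc)
qed

section \<open>Splitting Pochhammer symbols into parameter blocks\<close>

text \<open>Passing from $n$ to $n+1$ adds $m$ consecutive factors, one per residue: $A + mn + i =
  m((A+i)/m + n)$.\<close>

lemma pochhammer_mult_arg:
  fixes A :: "'a::field_char_0"
  assumes "m > 0"
  shows "pochhammer A (m * n) =
    of_nat m ^ (m * n) * (\<Prod>i<m. pochhammer ((A + of_nat i) / of_nat m) n)"
proof (induction n)
  case (Suc n)
  have "pochhammer A (m * Suc n) = pochhammer A (m * n) * pochhammer (A + of_nat (m * n)) m"
    using pochhammer_product'[of A "m * n" m] by (simp add: add.commute)
  also have "pochhammer (A + of_nat (m * n)) m =
      (\<Prod>i<m. of_nat m * ((A + of_nat i) / of_nat m + of_nat n))"
    unfolding pochhammer_prod atLeast0LessThan using assms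
    by (intro prod.cong) (auto simp: field_simps)
  finally show ?case
    by (simp add: Suc pochhammer_Suc prod.distrib power_add mult_ac)
qed simp

lemma gbinomial_eq_pochhammer_quotient:
  fixes A :: "'a::field_char_0"
  assumes "m > 0" and nz: "(\<Prod>i<m. pochhammer ((A + of_nat i) / of_nat m) n) \<noteq> 0"
  shows "(- A - of_nat (m * n)) gchoose n =
    (- 1) ^ n / fact n *
    ((\<Prod>i<Suc m. pochhammer ((A + of_nat i) / of_nat (Suc m)) n) /
      (\<Prod>i<m. pochhammer ((A + of_nat i) / of_nat m) n)) *
    ((of_nat (Suc m) ^ Suc m) ^ n / (of_nat m ^ m) ^ n)"
proof -
  have nz': "pochhammer A (m * n) \<noteq> 0"
    using assms by (simp add: pochhammer_mult_arg[OF assms(1)])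
  have "- (- A - of_nat (m * n)) = A + of_nat (m * n)"
    by simp
  then have "(- A - of_nat (m * n)) gchoose n = (- 1) ^ n * pochhammer (A + of_nat (m * n)) n / fact n"
    by (simp only: gbinomial_pochhammer)
  also have "pochhammer (A + of_nat (m * n)) n = pochhammer A (Suc m * n) / pochhammer A (m * n)"
    using nz' pochhammer_product'[of A "m * n" n] by (simp add: add.commute)
  also have "\<dots> = ((\<Prod>i<Suc m. pochhammer ((A + of_nat i) / of_nat (Suc m)) n) /
      (\<Prod>i<m. pochhammer ((A + of_nat i) / of_nat m) n)) *
    ((of_nat (Suc m) ^ Suc m) ^ n / (of_nat m ^ m) ^ n)" (is "_ = ?r")
    by (simp only: pochhammer_mult_arg[OF assms(1)] pochhammer_mult_arg[OF zero_less_Suc] power_mult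
        times_divide_times_eq) (simp only: mult.commute)
  finally have "(- A - of_nat (m * n)) gchoose n = (- 1) ^ n * ?r / fact n" .
  moreover have "(- 1) ^ n * ?r / fact n = (- 1) ^ n / fact n * ?r"
    by (simp only: times_divide_eq_left)
  ultimately show ?thesis
    by (simp only: mult.assoc)
qed

section \<open>Products over parameter lists, telescoping and lengths\<close>

lemma foldl_mult_eq_prod_list:
  "foldl (\<lambda>r a. r * f a) c xs = (c :: 'a::comm_monoid_mult) * prod_list (map f xs)"
  by (induction xs arbitrary: c) (auto simp: mult.assoc)

lemma prod_list_map_concat:
  "prod_list (map f (concat xss)) = (prod_list (map (\<lambda>xs. prod_list (map f xs)) xss) :: 'a::comm_monoid_mult)"
  by (induction xss) auto

lemma prod_list_map_upt:
  "prod_list (map f [a..<b]) = (prod f {a..<b} :: 'a::comm_monoid_mult)"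
  using prod.distinct_set_conv_list[of "[a..<b]" f] by simp

lemma prod_telescope_down:
  fixes q :: "nat \<Rightarrow> 'a::field"
  assumes "\<And>m. q m \<noteq> 0" "k \<le> N"
  shows "(\<Prod>l = 1..k. q (Suc (N - l)) / q (N - l)) = q N / q (N - k)"
  using assms(2)
proof (induction k)
  case (Suc k)
  then show ?case
    using assms(1) by (simp add: Suc_diff_Suc)
qed (simp add: assms(1))

text \<open>Counts the parameters in the blocks: $c = 3$ for $u$, $c = 2$ for $v$. The form avoids
  both division and truncated subtraction.\<close>

lemma sum_list_upt_diff:
  "2 * (\<Sum>l\<leftarrow>[1..<Suc k]. c + k - l) + k = k * (2 * c + k)" for c k :: nat
proof -
  have "2 * (\<Sum>l = 1..k. c + k - l) + k = k * (2 * c + k)"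
  proof (induction k arbitrary: c)
    case (Suc k)
    show ?case
      using Suc[of "Suc c"] by (simp add: algebra_simps)
  qed simp
  then show ?thesis
    by (simp add: interv_sum_list_conv_sum_set_nat atLeastLessThanSuc_atLeastAtMost del: upt_Suc)
qed

section \<open>Comparison with the hypergeometric coefficients\<close>

theorem theorem4:
  fixes N M :: nat and bs :: "nat \<Rightarrow> rat" and b :: rat
  assumes "N \<ge> 2"
    and "bs N \<noteq> 0"
    and "bs (N - 1) + bs N = - 1"
    and "M = N * (N + 1) div 2"
    and hypergeo_defined: "\<And>c j. c \<in> set (v_params N bs b) \<Longrightarrow> c + of_nat j \<noteq> 0"
  shows "length (u_params N bs b) = M - 1 \<and> length (v_params N bs b) = M - 2 \<and>
    Diag N (one_plus_powr ((\<Sum>i = 1..N - 2. mvar i) + 2 * mvar (N - 1)) b * R_series N bs) =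
      fps_hypergeo (u_params N bs b) (v_params N bs b) ((- of_nat N) ^ N)"
proof -
  obtain k where N: "N = Suc (Suc k)"
    using assms(1) by (metis One_nat_def Suc_1 Suc_le_D Suc_le_mono)
  have "even ((k + 2) * (k + 3))"
    by simp
  moreover have "N * (N + 1) = (k + 2) * (k + 3)"
    by (simp add: N algebra_simps)
  ultimately have M: "2 * M = (k + 2) * (k + 3)"
    using assms(4) by (metis dvd_mult_div_cancel)
  have "length (u_params N bs b) = (\<Sum>l\<leftarrow>[1..<Suc k]. Suc (N - l)) + 2"
    by (simp add: u_params_def u_block_def length_concat comp_def N del: upt_Suc)
  moreover have "map (\<lambda>l. Suc (N - l)) [1..<Suc k] = map (\<lambda>l. 3 + k - l) [1..<Suc k]"
    by (auto simp: N simp del: upt_Suc)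
  ultimately have "length (u_params N bs b) = (\<Sum>l\<leftarrow>[1..<Suc k]. 3 + k - l) + 2"
    by (simp only:)
  then have lenu: "length (u_params N bs b) = M - 1"
    using sum_list_upt_diff[of 3 k] M by (simp add: algebra_simps del: upt_Suc)
  have "length (v_params N bs b) = (\<Sum>l\<leftarrow>[1..<Suc k]. 2 + k - l) + Suc k"
    by (simp add: v_params_def v_block_def length_concat comp_def N del: upt_Suc)
  then have lenv: "length (v_params N bs b) = M - 2"
    using sum_list_upt_diff[of 2 k] M by (simp add: algebra_simps del: upt_Suc)
  define A where "A l = B_sum N bs l - b" for l
  define U where "U n l = (\<Prod>i<Suc (N - l). pochhammer ((A l + of_nat i) / of_nat (Suc (N - l))) n)" for n l
  define V where "V n l = (\<Prod>i<N - l. pochhammer ((A l + of_nat i) / of_nat (N - l)) n)" for n l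
  have "prod_list (map (\<lambda>a. pochhammer a n) (u_block N bs b l)) = U n l" for n l
    by (simp only: u_block_def map_map comp_def prod_list_map_upt atLeast0LessThan U_def A_def Suc_eq_plus1)
  then have U: "foldl (\<lambda>r a. r * pochhammer a n) 1 (u_params N bs b) =
      (\<Prod>l = 1..k. U n l) * pochhammer ((1 - b) / 2) n * pochhammer (- bs N) n" for n
    by (simp add: foldl_mult_eq_prod_list u_params_def prod_list_map_concat comp_def N
        prod_list_map_upt atLeastLessThanSuc_atLeastAtMost mult.assoc del: upt_Suc)
  have "prod_list (map (\<lambda>a. pochhammer a n) (v_block N bs b l)) = V n l" for n l
    by (simp only: v_block_def map_map comp_def prod_list_map_upt atLeast0LessThan V_def A_def)
  then have V: "foldl (\<lambda>r a. r * pochhammer a n) 1 (v_params N bs b) =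
      (\<Prod>l = 1..k. V n l) * fact n ^ Suc k" for n
    by (simp add: foldl_mult_eq_prod_list v_params_def prod_list_map_concat comp_def N
        prod_list_map_upt atLeastLessThanSuc_atLeastAtMost prod_list_replicate
        pochhammer_fact[symmetric] del: upt_Suc)
  \<comment> \<open>A vanishing Pochhammer symbol would make some lower parameter a nonpositive
    integer, which \<open>hypergeo_defined\<close> excludes.\<close>
  have Vnz: "V n l \<noteq> 0" if "l \<in> {1..k}" for n l
  proof -
    have "pochhammer ((A l + of_nat i) / of_nat (N - l)) n \<noteq> 0" if "i < N - l" for i
    proof
      assume "pochhammer ((A l + of_nat i) / of_nat (N - l)) n = 0"
      then obtain j where "(A l + of_nat i) / of_nat (N - l) = - of_nat j"
        by (auto simp: pochhammer_eq_0_iff)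
      moreover have "(A l + of_nat i) / of_nat (N - l) \<in> set (v_params N bs b)"
      proof -
        have "(A l + of_nat i) / of_nat (N - l) \<in> set (v_block N bs b l)"
          using that by (auto simp: v_block_def A_def)
        moreover have "l \<in> set [1..<N - 1]"
          using \<open>l \<in> {1..k}\<close> by (simp add: N del: upt_Suc)
        ultimately show ?thesis
          unfolding v_params_def set_append set_concat set_map by blast
      qed
      ultimately show False
        using hypergeo_defined[of _ j] by fastforce
    qed
    then show ?thesis
      by (simp add: V_def)
  qed
  define q :: "nat \<Rightarrow> nat \<Rightarrow> rat" where "q n m = (of_nat m ^ m) ^ n" for n m
  have "mcoeff (one_plus_powr ((\<Sum>i = 1..N - 2. mvar i) + 2 * mvar (N - 1)) b * R_series N bs)
      (\<Sum>i = 1..N. Poly_Mapping.single i n) =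
    fps_hypergeo (u_params N bs b) (v_params N bs b) ((- of_nat N) ^ N) $ n" for n
  proof -
    have factor: "(b - 1 - 2 * of_nat n + (\<Sum>i = l..k. bs i) - of_nat ((k - l) * n)) gchoose n =
        (- 1) ^ n / fact n * (U n l / V n l) * (q n (Suc (N - l)) / q n (N - l))"
      if l: "l \<in> {1..k}" for l
    proof -
      have "b - 1 - 2 * of_nat n + (\<Sum>i = l..k. bs i) - of_nat ((k - l) * n) =
          - A l - of_nat ((N - l) * n)"
      proof -
        \<comment> \<open>The hypothesis $b_{N-1} + b_N = -1$ enters again and accounts for the
          $-1$; the $2n$ is absorbed by $N - l = (k-l) + 2$.\<close>
        have "(\<Sum>i = l..N. bs i) = (\<Sum>i = l..k. bs i) - 1"
          using l assms(3) by (simp add: N)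
        moreover have "N - l = (k - l) + 2"
          using l by (auto simp: N)
        ultimately show ?thesis
          by (simp add: A_def B_sum_def algebra_simps)
      qed
      moreover have "N - l > 0"
        using l by (simp add: N)
      ultimately show ?thesis
        using gbinomial_eq_pochhammer_quotient[of "N - l" "A l" n] Vnz[OF l, of n]
        by (simp only: U_def V_def q_def not_False_eq_True simp_thms)
    qed
    \<comment> \<open>Also for \<open>m = 0\<close>, because \<open>0 ^ 0 = 1\<close>.\<close>
    have qnz: "q n m \<noteq> 0" for m
      by (cases m) (auto simp: q_def)
    have "(\<Prod>l = 1..k. (b - 1 - 2 * of_nat n + (\<Sum>i = l..k. bs i) - of_nat ((k - l) * n)) gchoose n) =
        (\<Prod>l = 1..k. (- 1) ^ n / fact n * (U n l / V n l) * (q n (Suc (N - l)) / q n (N - l)))"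
      by (rule prod.cong[OF refl factor])
    also have "\<dots> = ((- 1) ^ n / fact n) ^ k * ((\<Prod>l = 1..k. U n l) / (\<Prod>l = 1..k. V n l)) *
        (\<Prod>l = 1..k. q n (Suc (N - l)) / q n (N - l))"
      by (simp add: prod.distrib prod_dividef power_divide)
    \<comment> \<open>The last denominator is \<open>q n 2\<close>, that is $4^n$; it cancels the
      $4^n$ from the extraction of $x_{N-1}$.\<close>
    also have "(\<Prod>l = 1..k. q n (Suc (N - l)) / q n (N - l)) = q n N / 4 ^ n"
      using prod_telescope_down[of "q n" k N, OF qnz] by (simp add: N) (simp add: q_def)
    finally have 1: "(\<Prod>l = 1..k. (b - 1 - 2 * of_nat n + (\<Sum>i = l..k. bs i) - of_nat ((k - l) * n)) gchoose n) =
        ((- 1) ^ n / fact n) ^ k * ((\<Prod>l = 1..k. U n l) / (\<Prod>l = 1..k. V n l)) * (q n N / 4 ^ n)" .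
    have 2: "bs N gchoose n = (- 1) ^ n / fact n * pochhammer (- bs N) n"
      by (simp add: gbinomial_pochhammer)
    have "- ((b - 1) / 2) = (1 - b) / 2"
      by (simp only: minus_divide_left minus_diff_eq)
    then have 3: "(b - 1) / 2 gchoose n = (- 1) ^ n / fact n * pochhammer ((1 - b) / 2) n"
      by (simp only: gbinomial_pochhammer) simp
    \<comment> \<open>The $k+2 = N$ binomials contribute one sign $(-1)^n$ each, as many as
      $(-N)^{Nn}$ requires.\<close>
    have 4: "((- of_nat N) ^ N) ^ n = ((- 1) ^ n) ^ Suc (Suc k) * q n N"
      by (simp only: q_def N power_mult[symmetric] power_minus[of "of_nat _"] mult.commute power_mult_distrib)
    have "mcoeff (one_plus_powr ((\<Sum>i = 1..N - 2. mvar i) + 2 * mvar (N - 1)) b * R_series N bs)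
        (\<Sum>i = 1..N. Poly_Mapping.single i n) =
      (bs N gchoose n) * (4 ^ n * ((b - 1) / 2 gchoose n)) *
      (((- 1) ^ n / fact n) ^ k * ((\<Prod>l = 1..k. U n l) / (\<Prod>l = 1..k. V n l)) * (q n N / 4 ^ n))"
      using mcoeff_diag_R_series[of bs k b n] assms(3) unfolding 1 by (simp add: N)
    \<comment> \<open>Of the $k+2$ factorials, $k+1$ come from the ones in \<open>v_params\<close>
      and the last is the $n!$ of the hypergeometric series.\<close>
    also have "\<dots> = ((\<Prod>l = 1..k. U n l) * pochhammer ((1 - b) / 2) n * pochhammer (- bs N) n *
        ((- of_nat N) ^ N) ^ n) / ((\<Prod>l = 1..k. V n l) * fact n ^ Suc k * fact n)"
      unfolding 2 3 4 by (simp add: power_divide field_simps)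
    also have "\<dots> = fps_hypergeo (u_params N bs b) (v_params N bs b) ((- of_nat N) ^ N) $ n"
      by (simp only: fps_hypergeo_nth U V of_nat_fact)
    finally show ?thesis .
  qed
  then show ?thesis
    using lenu lenv by (auto simp: Diag_def intro!: fps_ext)
qed

end
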